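(* Let $\Sigma,\Lambda\in\mathrm{Cov}(n)$ and let $\gamma:[0,1]\to\mathrm{Cov}(n)$ be a minimizing curve from $\Sigma=\gamma(0)$ to $\Lambda=\gamma(1)$ for the Bures-Wasserstein distance. Then $\gamma$ has constant rank $p\ge\max(\mathrm{rk}(\Sigma),\mathrm{rk}(\Lambda))$ on $(0,1)$, i.e. there is an integer $p\ge\max(\mathrm{rk}(\Sigma),\mathrm{rk}(\Lambda))$ such that $\mathrm{rk}(\gamma(t))=p$ for all $t\in(0,1)$.
   Context: $\mathrm{Cov}(n)$ is the set of real symmetric positive semi-definite $n\times n$ matrices, endowed with the Bures-Wasserstein distance $d^{\mathrm{BW}}(\Sigma,\Lambda)=\inf\{\|X-Y\|_2: X,Y\in\mathbb{R}^{n\times n},\ XX^\top=\Sigma,\ YY^\top=\Lambda\}$, where $\|M\|_2=\mathrm{tr}(M^\top M)^{1/2}$; equivalently $d^{\mathrm{BW}}(\Sigma,\Lambda)=\mathrm{tr}(\Sigma+\Lambda-2(\Sigma^{1/2}\Lambda\Sigma^{1/2})^{1/2})^{1/2}$. A curve is a continuous map from an interval of $\mathbb{R}$. In a metric space $(\mathcal{M},d)$, the length of a curve $c:[a,b]\to\mathcal{M}$ is $L(c)=\sup\sum_i d(c(t_i),c(t_{i+1}))$ over all subdivisions of $[a,b]$. A curve $c:I\to\mathcal{M}$ is (globally) minimizing if $L(c|_{[a,b]})=d(c(a),c(b))$ for all $a\le b$ in $I$.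
   Formalization: The formal statement also assumes that, if Σ ≠ Λ, γ(t) differs from Σ and Λ for all t in (0,1); without this the claim fails, e.g. n=1, γ(t)=max(0,2t−1)² is minimizing from 0 to 1 but has rank 0 on (0,1/2] and rank 1 after. *)

theory Defs
  imports "HOL-Analysis.Analysis"
begin

definition Cov :: "(real^'n^'n) set" where
  "Cov = {A. transpose A = A \<and> (\<forall>x. 0 \<le> x \<bullet> (A *v x))}"

definition frobenius_norm :: "real^'n^'n \<Rightarrow> real" where
  "frobenius_norm M = sqrt (trace (transpose M ** M))"

definition bw_dist :: "real^'n^'n \<Rightarrow> real^'n^'n \<Rightarrow> real" where
  "bw_dist S L = Inf {frobenius_norm (X - Y) | X Y. X ** transpose X = S \<and> Y ** transpose Y = L}"

text \<open>In the following, \<open>M\<close> is the carrier and \<open>d\<close> the distance of a metric space; the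
  topology of a curve's codomain is the metric topology.\<close>

definition is_curve :: "'a set \<Rightarrow> ('a \<Rightarrow> 'a \<Rightarrow> real) \<Rightarrow> real set \<Rightarrow> (real \<Rightarrow> 'a) \<Rightarrow> bool" where
  "is_curve M d I c \<longleftrightarrow> is_interval I \<and> c \<in> I \<rightarrow> M \<and>
     continuous_map (top_of_set I) (Metric_space.mtopology M d) c"

definition curve_length :: "('a \<Rightarrow> 'a \<Rightarrow> real) \<Rightarrow> (real \<Rightarrow> 'a) \<Rightarrow> real \<Rightarrow> real \<Rightarrow> ereal" where
  "curve_length d c a b =
     Sup {ereal (\<Sum>i<k. d (c (t i)) (c (t (Suc i)))) | (k::nat) t.
            t 0 = a \<and> t k = b \<and> (\<forall>i<k. t i < t (Suc i))}"

definition minimizing_curve :: "'a set \<Rightarrow> ('a \<Rightarrow> 'a \<Rightarrow> real) \<Rightarrow> real set \<Rightarrow> (real \<Rightarrow> 'a) \<Rightarrow> bool" where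
  "minimizing_curve M d I c \<longleftrightarrow> is_curve M d I c \<and>
     (\<forall>a\<in>I. \<forall>b\<in>I. a \<le> b \<longrightarrow> curve_length d c a b = ereal (d (c a) (c b)))"

text \<open>The notion of minimizing curve does not constrain the parametrization, so such a curve may
  rest at an endpoint for a while: in dimension 1, \<open>t \<mapsto> (max 0 (2*t - 1))\<^sup>2\<close> on \<open>[0,1]\<close> is minimizing
  from 0 to 1, but has rank 0 on \<open>[0,1/2]\<close> and rank 1 afterwards. The following condition excludes
  only this; it holds for every constant-speed (e.g. arc-length) parametrization and for constant
  curves.\<close>

definition no_rest_at_ends :: "(real \<Rightarrow> 'a) \<Rightarrow> real \<Rightarrow> real \<Rightarrow> bool" where
  "no_rest_at_ends c a b \<longleftrightarrow> (c a \<noteq> c b \<longrightarrow> (\<forall>t\<in>{a<..<b}. c t \<noteq> c a \<and> c t \<noteq> c b))"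

end

theory Submission
  imports Defs
begin

text \<open>A \<^emph>\<open>factor\<close> of \<open>S\<close> is a square matrix \<open>X\<close> with \<open>X X\<^sup>T = S\<close>. Two factors of the same matrix
  differ by an orthogonal matrix acting on the right, and the set of factors is compact. So in the
  definition of the Bures-Wasserstein distance one of the two factors may be prescribed, and the
  infimum over the other one is attained (\<open>bw_dist_attained\<close>).

  For \<open>s < t\<close> in \<open>(0,1)\<close> this allows choosing, one after the other, factors \<open>X, P, Q, Y\<close> of
  \<open>S, \<gamma> s, \<gamma> t, L\<close> such that consecutive ones are at Euclidean distance exactly the distance of the
  matrices. As \<open>\<gamma>\<close> is minimizing, these three distances add up to at most the distance of \<open>S\<close> and
  \<open>L\<close>, which is at most \<open>norm (X - Y)\<close>. This is the equality case of the triangle inequality in a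
  Euclidean space: \<open>P\<close> and \<open>Q\<close> lie on the segment from \<open>X\<close> to \<open>Y\<close>, and \<open>X, Y\<close> is an optimal pair of
  factors of \<open>S\<close> and \<open>L\<close>. Since \<open>\<gamma>\<close> does not rest at its ends, \<open>P\<close> and \<open>Q\<close> are not end points of the
  segment, unless it is a single point.

  Optimality of the pair says that replacing \<open>Y\<close> by \<open>Y R\<close> with \<open>R\<close> orthogonal does not decrease the
  distance. With \<open>R\<close> the reflection along \<open>v\<close> this gives \<open>X v \<bullet> Y v \<ge> 0\<close>
  (\<open>optimal_factors_inner_nonneg\<close>). Hence if \<open>(1 - u) X v + u Y v = 0\<close> with \<open>0 < u < 1\<close>, the vectors
  \<open>X v\<close> and \<open>Y v\<close> point in opposite directions, and so both vanish: every matrix in the interior of the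
  segment has kernel \<open>ker X \<inter> ker Y\<close> (\<open>optimal_factors_segment_kernel\<close>). So \<open>P\<close> and \<open>Q\<close> have the
  same rank, at least that of \<open>X\<close> and of \<open>Y\<close>, and a matrix has the rank of its factors.\<close>

section \<open>Rank and kernel\<close>

text \<open>The row space meets the kernel only in \<open>0\<close>. So \<open>A\<close> is injective on the row space of \<open>B\<close>, and
  the image of that space has dimension \<open>rank B\<close>.\<close>

lemma rank_mono_kernel:
  fixes A :: "real^'n^'m" and B :: "real^'n^'k"
  assumes "\<And>x. A *v x = 0 \<Longrightarrow> B *v x = 0"
  shows "rank B \<le> rank A"
proof -
  have "inj_on ((*v) A) (span (rows B))"
  proof (rule inj_onI)
    fix x y assume xy: "x \<in> span (rows B)" "y \<in> span (rows B)" "A *v x = A *v y"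
    then have "A *v (x - y) = 0" by (simp add: matrix_vector_mult_diff_distrib)
    then have "B *v (x - y) = 0" by (rule assms)
    moreover have "x - y \<in> span (rows B)" using xy by (simp add: span_diff)
    ultimately have "x - y = 0" using nullspace_inter_rowspace by blast
    then show "x = y" by simp
  qed
  then have "dim ((*v) A ` rows B) = dim (rows B)"
    by (intro dim_image_eq) auto
  moreover have "dim ((*v) A ` rows B) \<le> dim (range ((*v) A))"
    by (intro dim_subset) auto
  ultimately show ?thesis by (simp add: row_rank_def[of B] rank_dim_range[of A])
qed

lemma rank_mult_transpose:
  fixes Z :: "real^'n^'m"
  shows "rank (Z ** transpose Z) = rank Z"
proof -
  have "transpose Z *v x = 0" if "(Z ** transpose Z) *v x = 0" for x
  proof -
    have "(transpose Z *v x) \<bullet> (transpose Z *v x) = x \<bullet> ((Z ** transpose Z) *v x)"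
      by (metis dot_lmul_matrix matrix_vector_mul_assoc transpose_matrix_vector)
    then show ?thesis using that by simp
  qed
  then have "rank (transpose Z) \<le> rank (Z ** transpose Z)" by (rule rank_mono_kernel)
  then show ?thesis
    using rank_mul_le_left[of Z "transpose Z"] by (simp add: rank_transpose)
qed

section \<open>Factors of positive semi-definite matrices\<close>

text \<open>The factors of \<open>S\<close> are the families of vectors, listed as rows, that have Gram matrix \<open>S\<close>.\<close>

lemma mult_transpose_eq_iff_rows:
  fixes X :: "real^'n^'m"
  shows "X ** transpose X = S \<longleftrightarrow> (\<forall>i j. X $ i \<bullet> X $ j = S $ i $ j)"
  by (simp add: vec_eq_iff matrix_matrix_mult_def transpose_def inner_vec_def)

lemma quadratic_form_add_axis:
  fixes A :: "real^'n^'n"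
  assumes "transpose A = A"
  shows "(x + t *\<^sub>R axis k 1) \<bullet> (A *v (x + t *\<^sub>R axis k 1))
           = x \<bullet> (A *v x) + 2 * t * (A $ k \<bullet> x) + t\<^sup>2 * A $ k $ k"
proof -
  have col: "A *v axis k 1 = A $ k"
    by (metis assms column_def matrix_vector_mult_basis row_def row_transpose vec_lambda_eta)
  have row: "axis k 1 \<bullet> (A *v x) = A $ k \<bullet> x"
    by (simp add: inner_axis' matrix_vector_mul_component)
  have "axis k 1 \<bullet> A $ k = A $ k $ k" by (simp add: inner_axis')
  with col row show ?thesis
    by (simp add: matrix_vector_right_distrib matrix_vector_mult_scaleR inner_add_left
        inner_add_right inner_commute[of x] power2_eq_square algebra_simps)
qed

text \<open>Cholesky elimination. If the diagonal entry at \<open>k\<close> is \<open>0\<close>, positivity forces the whole row to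
  vanish; otherwise subtracting a rank-one matrix clears row and column \<open>k\<close> and leaves a positive
  semi-definite matrix. The vectors \<open>w l\<close> are the columns of a factor. Letting the set \<open>F\<close> of rows
  still present shrink replaces an induction on the dimension, which is a type here.\<close>

lemma Cov_supported_factorization:
  fixes A :: "real^'n^'n"
  assumes "finite F" "A \<in> Cov" "\<And>i j. i \<notin> F \<Longrightarrow> A $ i $ j = 0"
  shows "\<exists>w :: 'n \<Rightarrow> real^'n. \<forall>i j. A $ i $ j = (\<Sum>l\<in>F. w l $ i * w l $ j)"
  using assms
proof (induction F arbitrary: A rule: finite_induct)
  case empty
  then show ?case by simp
next
  case (insert k F)
  have sym: "transpose A = A" and psd: "\<And>x. 0 \<le> x \<bullet> (A *v x)"
    using insert.prems(1) by (auto simp: Cov_def)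
  have symc: "A $ i $ j = A $ j $ i" for i j
    using sym by (metis transpose_def vec_lambda_beta)
  have diag: "0 \<le> A $ k $ k"
    using psd[of "0 + 1 *\<^sub>R axis k 1"] unfolding quadratic_form_add_axis[OF sym] by simp
  show ?case
  proof (cases "A $ k $ k = 0")
    case True
    have zero: "A $ k $ j = 0" for j
    proof (rule ccontr)
      assume nz: "A $ k $ j \<noteq> 0"
      define q where "q = axis j 1 \<bullet> (A *v axis j 1)"
      \<comment> \<open>without a quadratic term, the form is affine in \<open>t\<close>; this \<open>t\<close> makes it equal to \<open>-1\<close>\<close>
      define t where "t = - (q + 1) / (2 * A $ k $ j)"
      have "0 \<le> q + 2 * t * A $ k $ j"
        using psd[of "axis j 1 + t *\<^sub>R axis k 1"]
        unfolding quadratic_form_add_axis[OF sym] by (simp add: True q_def inner_axis)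
      moreover have "2 * t * A $ k $ j = - (q + 1)"
        using nz by (simp add: t_def)
      ultimately show False by simp
    qed
    have "\<exists>w :: 'n \<Rightarrow> real^'n. \<forall>i j. A $ i $ j = (\<Sum>l\<in>F. w l $ i * w l $ j)"
    proof (rule insert.IH[OF insert.prems(1)])
      show "A $ i $ j = 0" if "i \<notin> F" for i j
        using zero insert.prems(2)[of i j] that by (cases "i = k") auto
    qed
    then obtain w :: "'n \<Rightarrow> real^'n"
      where w: "\<And>i j. A $ i $ j = (\<Sum>l\<in>F. w l $ i * w l $ j)" by blast
    show ?thesis
      using insert.hyps
      by (intro exI[of _ "w(k := 0)"]) (auto simp: w intro!: sum.cong)
  next
    case False
    define a where "a = A $ k $ k"
    have a: "a > 0" using False diag by (simp add: a_def)
    \<comment> \<open>the Schur complement of the pivot at \<open>k\<close>\<close>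
    define B :: "real^'n^'n" where "B = (\<chi> i j. A $ i $ j - A $ k $ i * A $ k $ j / a)"
    have "transpose B = B"
      by (simp add: B_def transpose_def vec_eq_iff symc mult.commute)
    moreover have "0 \<le> x \<bullet> (B *v x)" for x
    proof -
      \<comment> \<open>the minimizer of the form of \<open>A\<close> on the line through \<open>x\<close> in direction \<open>k\<close>: the Schur
        complement takes the minimal value, which is nonnegative\<close>
      define t where "t = - (A $ k \<bullet> x) / a"
      have row: "B $ i = A $ i - (A $ k $ i / a) *\<^sub>R A $ k" for i
        by (simp add: B_def vec_eq_iff)
      have "B *v x = A *v x - ((A $ k \<bullet> x) / a) *\<^sub>R A $ k"
        by (simp add: vec_eq_iff matrix_vector_mul_component row inner_diff_left)
      then have "x \<bullet> (B *v x) = x \<bullet> (A *v x) - (A $ k \<bullet> x)\<^sup>2 / a"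
        by (simp add: inner_diff_right inner_commute[of x "A $ k"] power2_eq_square)
      also have "\<dots> = x \<bullet> (A *v x) + 2 * t * (A $ k \<bullet> x) + t\<^sup>2 * a"
        using a by (simp add: t_def field_simps power2_eq_square)
      also have "\<dots> \<ge> 0"
        using psd[of "x + t *\<^sub>R axis k 1"]
        unfolding quadratic_form_add_axis[OF sym] a_def by simp
      finally show ?thesis .
    qed
    ultimately have "B \<in> Cov" by (simp add: Cov_def)
    moreover have "B $ i $ j = 0" if "i \<notin> F" for i j
    proof (cases "i = k")
      case True
      then show ?thesis using a by (simp add: B_def a_def)
    next
      case False
      then show ?thesis
        using that insert.prems(2)[of i] symc[of k i] by (simp add: B_def)
    qed
    ultimately have "\<exists>w :: 'n \<Rightarrow> real^'n. \<forall>i j. B $ i $ j = (\<Sum>l\<in>F. w l $ i * w l $ j)"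
      by (rule insert.IH)
    then obtain w :: "'n \<Rightarrow> real^'n"
      where w: "\<And>i j. B $ i $ j = (\<Sum>l\<in>F. w l $ i * w l $ j)" by blast
    define v where "v = w(k := (1 / sqrt a) *\<^sub>R A $ k)"
    have "A $ i $ j = (\<Sum>l\<in>insert k F. v l $ i * v l $ j)" for i j
    proof -
      have "(\<Sum>l\<in>F. v l $ i * v l $ j) = (\<Sum>l\<in>F. w l $ i * w l $ j)"
        using insert.hyps by (intro sum.cong) (auto simp: v_def)
      moreover have "v k $ i * v k $ j = A $ k $ i * A $ k $ j / a"
        using a by (simp add: v_def field_simps)
      ultimately show ?thesis
        using insert.hyps w[of i j] by (simp add: B_def)
    qed
    then show ?thesis by blast
  qed
qed

lemma Cov_factorization:
  fixes A :: "real^'n^'n"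
  assumes "A \<in> Cov"
  obtains X :: "real^'n^'n" where "X ** transpose X = A"
proof -
  obtain w :: "'n \<Rightarrow> real^'n" where "\<And>i j. A $ i $ j = (\<Sum>l\<in>UNIV. w l $ i * w l $ j)"
    using Cov_supported_factorization[of UNIV A] assms by auto
  then have "(\<chi> i l. w l $ i) ** transpose (\<chi> i l. w l $ i) = A"
    by (simp add: vec_eq_iff matrix_matrix_mult_def transpose_def)
  then show ?thesis by (rule that)
qed

lemma compact_factors:
  fixes A :: "real^'m^'m"
  shows "compact {X :: real^'k^'m. X ** transpose X = A}"
proof -
  have "closed {X :: real^'k^'m. X $ i \<bullet> X $ j = A $ i $ j}" for i j
    by (intro closed_Collect_eq continuous_intros)
  then have "closed (\<Inter>i. \<Inter>j. {X :: real^'k^'m. X $ i \<bullet> X $ j = A $ i $ j})"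
    by (intro closed_INT) auto
  moreover have "{X :: real^'k^'m. X ** transpose X = A}
      = (\<Inter>i. \<Inter>j. {X. X $ i \<bullet> X $ j = A $ i $ j})"
    by (auto simp: mult_transpose_eq_iff_rows)
  moreover have "norm X \<le> sqrt (\<Sum>i\<in>UNIV. A $ i $ i)"
    if "X ** transpose X = A" for X :: "real^'k^'m"
    using that by (simp add: mult_transpose_eq_iff_rows norm_eq_sqrt_inner inner_vec_def)
  ultimately show ?thesis
    unfolding compact_eq_bounded_closed bounded_iff
    by (intro conjI exI[of _ "sqrt (\<Sum>i\<in>UNIV. A $ i $ i)"]) auto
qed

section \<open>Reflections\<close>

text \<open>The reflection in the hyperplane orthogonal to \<open>v\<close>; the identity for \<open>v = 0\<close>, by the
  convention for division by zero.\<close>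

definition reflection :: "'a::real_inner \<Rightarrow> 'a \<Rightarrow> 'a" where
  "reflection v x = x - (2 * (v \<bullet> x) / (v \<bullet> v)) *\<^sub>R v"

lemma orthogonal_transformation_reflection:
  "orthogonal_transformation (reflection (v :: 'a::real_inner))"
proof -
  have "linear (reflection v)"
    by (rule linearI)
      (simp_all add: reflection_def inner_add_right algebra_simps add_divide_distrib
        scaleR_add_left[symmetric] del: scaleR_add_left)
  moreover have "reflection v x \<bullet> reflection v y = x \<bullet> y" for x y
    by (cases "v = 0")
      (simp_all add: reflection_def inner_diff_left inner_diff_right inner_commute[of x v]
        field_simps)
  ultimately show ?thesis by (simp add: orthogonal_transformation_def)
qed

lemma reflection_diff_swap:
  assumes "norm x = norm y"
  shows "reflection (x - y) x = y"
proof (cases "x = y")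
  case True
  then show ?thesis by (simp add: reflection_def)
next
  case False
  have "x \<bullet> x = y \<bullet> y" using assms by (simp add: dot_square_norm)
  then have "2 * ((x - y) \<bullet> x) = (x - y) \<bullet> (x - y)"
    by (simp add: inner_diff_left inner_diff_right inner_commute[of x y])
  then show ?thesis using False by (simp add: reflection_def)
qed

text \<open>Families with the same Gram matrix are congruent. If \<open>Q\<close> already maps \<open>f i\<close> to \<open>g i\<close> for
  \<open>i \<in> F\<close>, compose it with the reflection that swaps \<open>Q (f k)\<close> and \<open>g k\<close>. Both vectors have the
  same inner products with every \<open>g i\<close>, so their difference is orthogonal to \<open>g i\<close> and the
  reflection does not undo what \<open>Q\<close> achieved.\<close>

lemma same_Gram_orthogonal_transformation:
  fixes f g :: "'i \<Rightarrow> 'a::real_inner"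
  assumes "finite F" "\<And>i j. i \<in> F \<Longrightarrow> j \<in> F \<Longrightarrow> f i \<bullet> f j = g i \<bullet> g j"
  shows "\<exists>Q. orthogonal_transformation Q \<and> (\<forall>i\<in>F. Q (f i) = g i)"
  using assms
proof (induction F rule: finite_induct)
  case empty
  then show ?case using orthogonal_transformation_id by blast
next
  case (insert k F)
  then obtain Q where Q: "orthogonal_transformation Q" "\<And>i. i \<in> F \<Longrightarrow> Q (f i) = g i"
    by auto
  define R where "R = reflection (Q (f k) - g k)"
  have "norm (Q (f k)) = norm (g k)"
    using Q(1) insert.prems[of k k]
    by (simp add: norm_eq_sqrt_inner orthogonal_transformation_def)
  then have "R (Q (f k)) = g k" unfolding R_def by (rule reflection_diff_swap)
  moreover have "R (Q (f i)) = g i" if "i \<in> F" for i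
  proof -
    have "Q (f k) \<bullet> g i = f k \<bullet> f i"
      using Q that by (metis orthogonal_transformation_def)
    also have "\<dots> = g k \<bullet> g i" using insert.prems that by blast
    finally have "(Q (f k) - g k) \<bullet> g i = 0" by (simp add: inner_diff_left)
    then show ?thesis using Q(2) that by (simp add: R_def reflection_def)
  qed
  moreover have "orthogonal_transformation (R \<circ> Q)"
    unfolding R_def
    using orthogonal_transformation_reflection Q(1) by (rule orthogonal_transformation_compose)
  ultimately show ?case by (intro exI[of _ "R \<circ> Q"]) (auto simp del: o_apply simp: o_apply[of R Q "f _"])
qed

text \<open>For an orthogonal transformation \<open>f\<close> this is multiplication on the right by an orthogonal
  matrix.\<close>

definition map_rows :: "('a \<Rightarrow> 'b) \<Rightarrow> 'a^'m \<Rightarrow> 'b^'m" where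
  "map_rows f X = (\<chi> i. f (X $ i))"

lemma map_rows_nth [simp]: "map_rows f X $ i = f (X $ i)"
  by (simp add: map_rows_def)

lemma map_rows_factor:
  fixes X :: "real^'n^'m"
  assumes "orthogonal_transformation Q" "X ** transpose X = A"
  shows "map_rows Q X ** transpose (map_rows Q X) = A"
  using assms by (simp add: mult_transpose_eq_iff_rows orthogonal_transformation_def)

lemma norm_map_rows_diff:
  fixes X Y :: "real^'n^'m"
  assumes "orthogonal_transformation Q"
  shows "norm (map_rows Q X - map_rows Q Y) = norm (X - Y)"
proof -
  have "norm (Q x - Q y) = norm (x - y)" for x y
    using assms by (metis linear_diff orthogonal_transformation)
  then show ?thesis by (simp add: norm_vec_def)
qed

section \<open>Optimal pairs of factors\<close>

lemma frobenius_norm_eq_norm: "frobenius_norm M = norm M"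
proof -
  have "trace (transpose M ** M) = (\<Sum>j\<in>UNIV. \<Sum>i\<in>UNIV. M $ i $ j * M $ i $ j)"
    by (simp add: trace_def matrix_matrix_mult_def transpose_def)
  also have "\<dots> = M \<bullet> M"
    by (subst sum.swap) (simp add: inner_vec_def)
  finally show ?thesis by (simp add: frobenius_norm_def norm_eq_sqrt_inner)
qed

lemma bw_dist_eq_Inf_norm:
  fixes S L :: "real^'n^'n"
  shows "bw_dist S L = Inf {norm (X - Y) | X Y :: real^'n^'n. X ** transpose X = S \<and> Y ** transpose Y = L}"
  by (simp add: bw_dist_def frobenius_norm_eq_norm)

lemma bw_dist_le_norm:
  fixes X Y :: "real^'n^'n"
  assumes "X ** transpose X = S" "Y ** transpose Y = L"
  shows "bw_dist S L \<le> norm (X - Y)"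
  unfolding bw_dist_eq_Inf_norm
  by (rule cInf_lower) (use assms in \<open>auto intro!: bdd_belowI[of _ 0]\<close>)

text \<open>Any pair of factors can be rotated by a common orthogonal transformation so that its first
  component becomes the prescribed \<open>X\<close>, without changing the distance. So it suffices to minimize
  over the compact set of factors of \<open>L\<close>.\<close>

lemma bw_dist_attained:
  fixes S L X :: "real^'n^'n"
  assumes "L \<in> Cov" and X: "X ** transpose X = S"
  obtains Y :: "real^'n^'n" where "Y ** transpose Y = L" "norm (X - Y) = bw_dist S L"
proof -
  let ?K = "{Y :: real^'n^'n. Y ** transpose Y = L}"
  have "?K \<noteq> {}" using Cov_factorization[OF assms(1)] by blast
  moreover have "continuous_on ?K (\<lambda>Y. norm (X - Y))" by (intro continuous_intros)
  ultimately obtain Y where Y: "Y ** transpose Y = L"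
    and min: "\<And>Y'. Y' ** transpose Y' = L \<Longrightarrow> norm (X - Y) \<le> norm (X - Y')"
    using continuous_attains_inf[OF compact_factors, of L "\<lambda>Y. norm (X - Y)"] by blast
  have "norm (X - Y) \<le> norm (X' - Y')"
    if X': "X' ** transpose X' = S" and Y': "Y' ** transpose Y' = L"
    for X' Y' :: "real^'n^'n"
  proof -
    have "\<exists>Q. orthogonal_transformation Q \<and> (\<forall>i\<in>UNIV. Q (X' $ i) = X $ i)"
      using X X' same_Gram_orthogonal_transformation[of UNIV "\<lambda>i. X' $ i" "\<lambda>i. X $ i"]
      by (simp add: mult_transpose_eq_iff_rows)
    then obtain Q where Q: "orthogonal_transformation Q" "\<And>i. Q (X' $ i) = X $ i" by auto
    have "map_rows Q X' = X" using Q(2) by (simp add: vec_eq_iff)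
    then have "norm (X' - Y') = norm (X - map_rows Q Y')"
      using norm_map_rows_diff[OF Q(1), of X' Y'] by simp
    then show ?thesis using min[OF map_rows_factor[OF Q(1) Y']] by simp
  qed
  then have "norm (X - Y) = bw_dist S L"
    unfolding bw_dist_eq_Inf_norm using X Y
    by (intro cInf_eq_minimum[symmetric]) auto
  with Y show ?thesis by (rule that)
qed

lemma bw_dist_self:
  fixes S :: "real^'n^'n"
  assumes "S \<in> Cov"
  shows "bw_dist S S \<le> 0"
proof -
  obtain X :: "real^'n^'n" where X: "X ** transpose X = S" by (rule Cov_factorization[OF assms])
  show ?thesis using bw_dist_le_norm[OF X X] by simp
qed

text \<open>Reflecting the rows of \<open>Y\<close> along \<open>v\<close> gives another factor of \<open>Y Y\<^sup>T\<close>, and adds a positive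
  multiple of \<open>(X v) \<bullet> (Y v)\<close> to the squared distance from \<open>X\<close>. By optimality this cannot be
  negative.\<close>

lemma optimal_factors_inner_nonneg:
  fixes X Y :: "real^'n^'n"
  assumes opt: "norm (X - Y) = bw_dist (X ** transpose X) (Y ** transpose Y)"
  shows "0 \<le> (X *v v) \<bullet> (Y *v v)"
proof (cases "v = 0")
  case False
  let ?R = "map_rows (reflection v)"
  define c where "c = v \<bullet> v"
  have c: "c > 0" using False by (simp add: c_def)
  have row: "(x - reflection v y) \<bullet> (x - reflection v y)
      = (x - y) \<bullet> (x - y) + 4 / c * ((x \<bullet> v) * (y \<bullet> v))" for x y
  proof -
    define k where "k = 2 * (y \<bullet> v) / c"
    have "x - reflection v y = (x - y) + k *\<^sub>R v"
      by (simp add: reflection_def k_def c_def inner_commute[of v y])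
    then have "(x - reflection v y) \<bullet> (x - reflection v y)
        = (x - y) \<bullet> (x - y) + 2 * k * ((x - y) \<bullet> v) + k * (k * c)"
      by (simp only:) (simp add: inner_add_left inner_add_right inner_commute[of v "x - y"] c_def
        ring_distribs)
    also have "k * c = 2 * (y \<bullet> v)" using c by (simp add: k_def)
    also have "(x - y) \<bullet> (x - y) + 2 * k * ((x - y) \<bullet> v) + k * (2 * (y \<bullet> v))
        = (x - y) \<bullet> (x - y) + 2 * k * (x \<bullet> v)"
      by (simp add: inner_diff_left[of x y v] algebra_simps)
    finally show ?thesis by (simp add: k_def)
  qed
  have "norm (X - Y) \<le> norm (X - ?R Y)"
    unfolding opt
    by (intro bw_dist_le_norm map_rows_factor orthogonal_transformation_reflection refl)
  then have "(X - Y) \<bullet> (X - Y) \<le> (X - ?R Y) \<bullet> (X - ?R Y)"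
    by (simp add: norm_le)
  also have "\<dots> = (X - Y) \<bullet> (X - Y) + 4 / c * ((X *v v) \<bullet> (Y *v v))"
    by (simp add: inner_vec_def[of "X - ?R Y"] inner_vec_def[of "X - Y"]
        inner_vec_def[of "X *v v"] row sum.distrib sum_distrib_left matrix_vector_mul_component)
  finally show ?thesis using c by (simp add: zero_le_divide_iff)
qed simp

lemma optimal_factors_segment_kernel:
  fixes X Y :: "real^'n^'n"
  assumes opt: "norm (X - Y) = bw_dist (X ** transpose X) (Y ** transpose Y)"
    and u: "0 < u" "u < 1"
  shows "((1 - u) *\<^sub>R X + u *\<^sub>R Y) *v v = 0 \<longleftrightarrow> X *v v = 0 \<and> Y *v v = 0"
proof -
  let ?x = "X *v v" and ?y = "Y *v v"
  have Zv: "((1 - u) *\<^sub>R X + u *\<^sub>R Y) *v v = (1 - u) *\<^sub>R ?x + u *\<^sub>R ?y"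
    by (simp add: matrix_vector_mult_add_rdistrib scaleR_matrix_vector_assoc)
  have "?x = 0 \<and> ?y = 0" if z: "(1 - u) *\<^sub>R ?x + u *\<^sub>R ?y = 0"
  proof -
    have "0 = ((1 - u) *\<^sub>R ?x + u *\<^sub>R ?y) \<bullet> ?y" using z by simp
    also have "\<dots> = (1 - u) * (?x \<bullet> ?y) + u * (?y \<bullet> ?y)" by (simp add: inner_add_left)
    finally have "u * (?y \<bullet> ?y) = - ((1 - u) * (?x \<bullet> ?y))" by simp
    also have "\<dots> \<le> 0" using optimal_factors_inner_nonneg[OF opt, of v] u by simp
    finally have "?y \<bullet> ?y \<le> 0" using u by (simp add: mult_le_0_iff)
    then have "?y = 0" by (simp add: not_less[symmetric])
    then show ?thesis using z u by simp
  qed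
  then show ?thesis unfolding Zv by auto
qed

section \<open>Minimizing curves\<close>

text \<open>The only way in which the length of the curve enters: the subdivision with the two interior
  points \<open>s\<close> and \<open>t\<close>.\<close>

lemma curve_length_ge:
  assumes "a < s" "s < t" "t < b"
  shows "ereal (d (c a) (c s) + d (c s) (c t) + d (c t) (c b)) \<le> curve_length d c a b"
proof -
  define r where
    "r i = (if i = 0 then a else if i = 1 then s else if i = 2 then t else b)" for i :: nat
  have "(\<Sum>i<3. d (c (r i)) (c (r (Suc i)))) = d (c a) (c s) + d (c s) (c t) + d (c t) (c b)"
    by (simp add: r_def numeral_3_eq_3)
  moreover have "r 0 = a \<and> r 3 = b \<and> (\<forall>i<3. r i < r (Suc i))"
    using assms by (auto simp: r_def less_Suc_eq numeral_3_eq_3)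
  ultimately show ?thesis
    unfolding curve_length_def by (intro Sup_upper CollectI exI[of _ 3] exI[of _ r]) simp
qed

text \<open>In the degenerate case \<open>X = Y\<close> any \<open>u\<close> in \<open>(0,1)\<close> serves as the parameter of \<open>Z\<close>. A constant
  curve is covered in this way.\<close>

lemma intermediate_point_in_open_segment:
  fixes X Y Z :: "'a::euclidean_space"
  assumes "norm (X - Z) + norm (Z - Y) \<le> norm (X - Y)" and "X = Y \<or> Z \<noteq> X \<and> Z \<noteq> Y"
  obtains u where "0 < u" "u < 1" "Z = (1 - u) *\<^sub>R X + u *\<^sub>R Y"
proof (cases "X = Y")
  case True
  then have "norm (Z - X) \<le> 0"
    using assms(1) norm_ge_zero[of "Z - X"] by (simp add: norm_minus_commute)
  then have "Z = (1 - 1/2) *\<^sub>R X + (1/2) *\<^sub>R Y"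
    unfolding True[symmetric] scaleR_collapse by simp
  then show ?thesis by (intro that[of "1/2"]) auto
next
  case False
  have "dist X Y = dist X Z + dist Z Y"
    using assms(1) dist_triangle[of X Y Z] by (simp add: dist_norm)
  then have "Z \<in> closed_segment X Y"
    by (simp add: between_mem_segment[symmetric] between)
  then obtain u where "0 \<le> u" "u \<le> 1" and Z: "Z = (1 - u) *\<^sub>R X + u *\<^sub>R Y"
    by (auto simp: in_segment)
  moreover have "u \<noteq> 0" "u \<noteq> 1" using Z False assms(2) by auto
  ultimately show ?thesis using that[of u] by linarith
qed

text \<open>Both interior points are treated in one chain: the optimal pair of factors \<open>X, Y\<close> depends on
  the points it was built through, and the ranks can be compared only inside a common segment.\<close>

lemma rank_between:
  fixes S M N L :: "real^'n^'n"
  assumes Cov: "S \<in> Cov" "M \<in> Cov" "N \<in> Cov" "L \<in> Cov"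
    and sum: "bw_dist S M + bw_dist M N + bw_dist N L \<le> bw_dist S L"
    and distinct: "S \<noteq> L \<Longrightarrow> M \<noteq> S \<and> M \<noteq> L \<and> N \<noteq> S \<and> N \<noteq> L"
  shows "rank M = rank N \<and> max (rank S) (rank L) \<le> rank M"
proof -
  obtain X :: "real^'n^'n" where X: "X ** transpose X = S" by (rule Cov_factorization[OF Cov(1)])
  obtain P :: "real^'n^'n" where P: "P ** transpose P = M" "norm (X - P) = bw_dist S M"
    by (rule bw_dist_attained[OF Cov(2) X])
  obtain Q :: "real^'n^'n" where Q: "Q ** transpose Q = N" "norm (P - Q) = bw_dist M N"
    by (rule bw_dist_attained[OF Cov(3) P(1)])
  obtain Y :: "real^'n^'n" where Y: "Y ** transpose Y = L" "norm (Q - Y) = bw_dist N L"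
    by (rule bw_dist_attained[OF Cov(4) Q(1)])
  have chain: "norm (X - P) + norm (P - Q) + norm (Q - Y) \<le> bw_dist S L"
    using P Q Y sum by simp
  have le: "bw_dist S L \<le> norm (X - Y)" using X Y by (intro bw_dist_le_norm)
  have tri: "norm (X - Y) \<le> norm (X - P) + norm (P - Y)"
    "norm (X - Y) \<le> norm (X - Q) + norm (Q - Y)"
    "norm (P - Y) \<le> norm (P - Q) + norm (Q - Y)"
    "norm (X - Q) \<le> norm (X - P) + norm (P - Q)"
    using dist_triangle[of X Y P] dist_triangle[of X Y Q] dist_triangle[of P Y Q]
      dist_triangle[of X Q P] by (simp_all add: dist_norm)
  have "norm (X - Y) = bw_dist S L" using chain le tri by linarith
  then have opt: "norm (X - Y) = bw_dist (X ** transpose X) (Y ** transpose Y)"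
    using X Y by simp
  have XY: "X = Y" if "S = L"
  proof -
    have "norm (X - Y) \<le> 0"
      using that bw_dist_self[OF Cov(1)] \<open>norm (X - Y) = bw_dist S L\<close> by simp
    then show ?thesis by simp
  qed
  have kernel: "Z *v v = 0 \<longleftrightarrow> X *v v = 0 \<and> Y *v v = 0" if "Z \<in> {P, Q}" for Z v
  proof -
    have "norm (X - Z) + norm (Z - Y) \<le> norm (X - Y)"
      using that chain le tri by auto
    moreover have "X = Y \<or> Z \<noteq> X \<and> Z \<noteq> Y"
      using that X Y P Q XY distinct by auto
    ultimately obtain u where "0 < u" "u < 1" "Z = (1 - u) *\<^sub>R X + u *\<^sub>R Y"
      by (rule intermediate_point_in_open_segment)
    then show ?thesis using optimal_factors_segment_kernel[OF opt] by simp
  qed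
  have "rank P = rank Q"
  proof (rule antisym)
    show "rank P \<le> rank Q" "rank Q \<le> rank P"
      using kernel by (auto intro!: rank_mono_kernel)
  qed
  moreover have "rank X \<le> rank P" "rank Y \<le> rank P"
    using kernel by (auto intro!: rank_mono_kernel)
  ultimately show ?thesis
    using rank_mult_transpose[of X] rank_mult_transpose[of Y] rank_mult_transpose[of P]
      rank_mult_transpose[of Q] X Y P Q by simp
qed

theorem lemma6p1:
  fixes S L :: "real^'n^'n" and \<gamma> :: "real \<Rightarrow> real^'n^'n"
  assumes "S \<in> Cov" and "L \<in> Cov"
    and "minimizing_curve Cov bw_dist {0..1} \<gamma>"
    and "\<gamma> 0 = S" and "\<gamma> 1 = L"
    and "no_rest_at_ends \<gamma> 0 1"
  shows "\<exists>p::nat. p \<ge> max (rank S) (rank L) \<and> (\<forall>t\<in>{0<..<1}. rank (\<gamma> t) = p)"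
proof -
  have Cov: "\<gamma> t \<in> Cov" if "t \<in> {0<..<1}" for t
    using assms(3) that by (auto simp: minimizing_curve_def is_curve_def)
  have "curve_length bw_dist \<gamma> 0 1 = ereal (bw_dist S L)"
    using assms(3-5) by (auto simp: minimizing_curve_def)
  then have sum: "bw_dist S (\<gamma> s) + bw_dist (\<gamma> s) (\<gamma> t) + bw_dist (\<gamma> t) L \<le> bw_dist S L"
    if "0 < s" "s < t" "t < 1" for s t
    using curve_length_ge[OF that, of bw_dist \<gamma>] assms(4,5) by simp
  have rank: "rank (\<gamma> s) = rank (\<gamma> t) \<and> max (rank S) (rank L) \<le> rank (\<gamma> s)"
    if "0 < s" "s < t" "t < 1" for s t
  proof (rule rank_between)
    show "S \<noteq> L \<Longrightarrow> \<gamma> s \<noteq> S \<and> \<gamma> s \<noteq> L \<and> \<gamma> t \<noteq> S \<and> \<gamma> t \<noteq> L"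
      using assms(4-6) that by (auto simp: no_rest_at_ends_def)
  qed (use assms(1,2) Cov sum that in auto)
  have "rank (\<gamma> t) = rank (\<gamma> (1/2))" if "t \<in> {0<..<1}" for t
    using rank[of t "1/2"] rank[of "1/2" t] that by (cases "t = 1/2") force+
  moreover have "max (rank S) (rank L) \<le> rank (\<gamma> (1/2))"
    using rank[of "1/2" "3/4"] by simp
  ultimately show ?thesis by blast
qed

end
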